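(* Let $c$ be an $n\times n$ real positive semi-definite symmetric matrix and let $b=(b_{ijk})\in\mathbb{R}^{n^3}$. Consider the set of $n^3$ equations in the unknowns $(a_{ijk})_{i,j,k=1,\dots,n}$ $$a_{ijk}+c_{jk}\sum_{q=1}^na_{qiq}=b_{ijk},\qquad i,j,k=1,\dots,n,$$ and let $L$ be the $n^3\times n^3$ matrix associated with this system. Then: \begin{enumerate} \item the matrix $L$ is invertible and $\det(L)=\det(I_n+c)$; \item the unique solution of the system is $$a_{ijk}=b_{ijk}-c_{jk}\bigl[(I_n+c)^{-1}h\bigr]_i,$$ where $h=(h_1,\dots,h_n)$ is defined by $h_i:=\sum_{q}b_{qiq}$. \end{enumerate} In particular, if $c$ is an orthogonal projector of rank $d$, or $c=\int_{G_{d,n}}S\,d\nu(S)$ for a probability measure $\nu$ on $G_{d,n}$, then $c$ is positive semi-definite and symmetric. Moreover, there exists a dimensional constant $C_0>0$ such that, for all such $c$ (orthogonal projectors of rank $d$, or averages $\int_{G_{d,n}}S\,d\nu(S)$) and all $b$, with $a$ the corresponding solution, $$\|(I_n+c)^{-1}\|\le C_0\quad\text{and}\quad\sup_{ijk}|a_{ijk}|\le C_0\sup_{ijk}|b_{ijk}|.$$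
   Context: $1\le d\le n$ are integers. $G_{d,n}$ is the Grassmannian of $d$-dimensional linear subspaces of $\mathbb{R}^n$, each element $S$ being identified with the matrix of the orthogonal projection of $\mathbb{R}^n$ onto it. $I_n$ is the identity matrix and $\|\cdot\|$ is the operator norm. Rows (equations) and columns (unknowns) of $L$ are indexed by the triples $(i,j,k)$ in the same (lexicographic) order. "Dimensional constant" means depending only on the dimensions $n$ and $d$. *)

theory Defs
  imports "HOL-Probability.Probability"
begin

definition pos_semidef :: "real^'n^'n \<Rightarrow> bool" where
  "pos_semidef c \<longleftrightarrow> transpose c = c \<and> (\<forall>x. 0 \<le> x \<bullet> (c *v x))"

definition is_solution ::
    "real^'n^'n \<Rightarrow> real^('n \<times> 'n \<times> 'n) \<Rightarrow> real^('n \<times> 'n \<times> 'n) \<Rightarrow> bool" where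
  "is_solution c b a \<longleftrightarrow>
     (\<forall>i j k. a $ (i,j,k) + c $ j $ k * (\<Sum>q\<in>UNIV. a $ (q,i,q)) = b $ (i,j,k))"

definition system_map :: "real^'n^'n \<Rightarrow> real^('n \<times> 'n \<times> 'n) \<Rightarrow> real^('n \<times> 'n \<times> 'n)" where
  "system_map c a =
     (\<chi> t. case t of (i,j,k) \<Rightarrow> a $ (i,j,k) + c $ j $ k * (\<Sum>q\<in>UNIV. a $ (q,i,q)))"

(* Rows and columns are both indexed by triples, so no enumeration of the triples has to be
   chosen: the determinant is the same for every common ordering of rows and columns. *)
definition system_matrix :: "real^'n^'n \<Rightarrow> real^('n \<times> 'n \<times> 'n)^('n \<times> 'n \<times> 'n)" where
  "system_matrix c = matrix (system_map c)"

lemma linear_system_map: "linear (system_map c)"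
  by (rule linearI)
     (auto simp: system_map_def vec_eq_iff sum.distrib sum_distrib_left algebra_simps)

lemma system_matrix_mult_iff: "system_matrix c *v a = b \<longleftrightarrow> is_solution c b a"
proof -
  have "system_matrix c *v a = system_map c a"
    unfolding system_matrix_def
    by (rule fun_cong[OF matrix_vector_mul(2)[OF linear_system_map]])
  then show ?thesis
    by (simp add: system_map_def is_solution_def vec_eq_iff)
qed

definition is_orth_projection_onto :: "real^'n^'n \<Rightarrow> (real^'n) set \<Rightarrow> bool" where
  "is_orth_projection_onto P S \<longleftrightarrow> (\<forall>x. P *v x \<in> S \<and> (\<forall>s\<in>S. (x - P *v x) \<bullet> s = 0))"

definition is_orth_projector :: "real^'n^'n \<Rightarrow> bool" where
  "is_orth_projector P \<longleftrightarrow> (\<exists>S. subspace S \<and> is_orth_projection_onto P S)"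

(* A subspace is identified with the matrix of the orthogonal projection onto it, so the
   Grassmannian is a set of matrices and inherits their topology. *)
definition grassmannian :: "nat \<Rightarrow> (real^'n^'n) set" where
  "grassmannian d = {P. \<exists>S. subspace S \<and> dim S = d \<and> is_orth_projection_onto P S}"

definition is_grassmannian_average :: "nat \<Rightarrow> real^'n^'n \<Rightarrow> bool" where
  "is_grassmannian_average d c \<longleftrightarrow>
     (\<exists>\<nu>. prob_space \<nu> \<and> sets \<nu> = sets (restrict_space borel (grassmannian d)) \<and>
          c = (\<integral>S. S \<partial>\<nu>))"

end

theory Submission imports Defs begin

text \<open>
  The sums \<open>u\<^sub>i = (\<Sum>q. a\<^sub>q\<^sub>i\<^sub>q)\<close> are the only quantities through which the equations are coupled.
  Writing \<open>V\<close> for the linear map \<open>a \<mapsto> u\<close> and \<open>U\<close> for the map sending \<open>u\<close> to the vector with entries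
  \<open>c\<^sub>j\<^sub>k u\<^sub>i\<close>, the system matrix is \<open>1 + U V\<close>, a perturbation of the identity that factors through
  the \<open>n\<close>-dimensional space, while \<open>V U = c\<close>. The determinant formula is therefore an instance of
  Sylvester's identity \<open>det (1 + U V) = det (1 + V U)\<close> (lemma \<open>det_one_plus_mult_commute\<close>), and
  applying \<open>V\<close> to the system gives \<open>(1 + c) u = h\<close>, from which \<open>u\<close> and then \<open>a\<close> are read off.

  Sylvester's identity comes from multiplying a lower triangular block matrix with another block
  matrix in both orders. The determinants of the two products are reduced to those of their
  nontrivial diagonal blocks by lemma \<open>det_identity_rows\<close>.

  The bounds rest on two facts. For positive semi-definite \<open>c\<close> one has
  \<open>|y|\<^sup>2 \<le> y \<bullet> (1 + c) y\<close>, so that \<open>1 + c\<close> does not shrink any vector; it is invertible and its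
  inverse has norm at most \<open>1\<close>. Orthogonal projections do not expand vectors, so their entries lie
  in \<open>[-1, 1]\<close>. This bound and positive semi-definiteness are both expressed by non-strict
  inequalities between a linear functional and a constant, hence survive averaging. As \<open>h\<close> consists of sums
  of \<open>n\<close> entries of \<open>b\<close>, its norm is at most \<open>n\<^sup>2 sup |b|\<close>, and \<open>1 + n\<^sup>2\<close> is an admissible constant.
\<close>

section \<open>Sylvester's determinant identity\<close>

text \<open>
  In the Leibniz expansion, a permutation contributes only if it fixes every index whose row is
  a row of the identity matrix. Such permutations are the permutations of the remaining indices,
  and relabelling these along \<open>f\<close> preserves signs.
\<close>

lemma det_identity_rows:
  fixes M :: "'a::comm_ring_1^'m^'m" and f :: "'n::finite \<Rightarrow> 'm::finite"
  assumes inj: "inj f"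
    and rows: "\<And>i j. i \<notin> range f \<Longrightarrow> M $ i $ j = (if i = j then 1 else 0)"
  shows "det M = det (\<chi> i j. M $ f i $ f j)"
proof -
  let ?F = "map_permutation UNIV f"
  let ?term = "\<lambda>p. of_int (sign p) * (\<Prod>i\<in>UNIV. M $ i $ p i)"
  have bij: "bij_betw f UNIV (range f)"
    using inj by (simp add: bij_betw_def)
  have F_permutes: "?F p permutes range f" if "p permutes UNIV" for p
    using map_permutation_permutes[OF bij that] .
  have "bij_betw ?F {p. p permutes UNIV} {p. p permutes range f}"
  proof (rule bij_betw_byWitness[where f' = "map_permutation (range f) (inv f)"])
    show "\<forall>p\<in>{p. p permutes UNIV}. map_permutation (range f) (inv f) (?F p) = p"
      using map_permutation_compose_inv[OF bij] inj by auto
    have bij': "bij_betw (inv f) (range f) UNIV"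
      using bij by (rule bij_betw_inv_into)
    show "\<forall>p\<in>{p. p permutes range f}. ?F (map_permutation (range f) (inv f) p) = p"
      using map_permutation_compose_inv[OF bij'] by (auto simp: f_inv_into_f)
    show "?F ` {p. p permutes UNIV} \<subseteq> {p. p permutes range f}"
      using F_permutes by auto
    show "map_permutation (range f) (inv f) ` {p. p permutes range f} \<subseteq> {p. p permutes UNIV}"
      using map_permutation_permutes[OF bij'] by auto
  qed
  then have reindex: "(\<Sum>p | p permutes range f. ?term p) = (\<Sum>p | p permutes UNIV. ?term (?F p))"
    by (rule sum.reindex_bij_betw[symmetric])
  have term_F: "?term (?F p) = of_int (sign p) * (\<Prod>i\<in>UNIV. M $ f i $ f (p i))"
    if p: "p permutes UNIV" for p
  proof -
    have "(\<Prod>i\<in>UNIV. M $ i $ ?F p i) = (\<Prod>i\<in>range f. M $ i $ ?F p i)"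
    proof (rule prod.mono_neutral_right)
      show "\<forall>i\<in>UNIV - range f. M $ i $ ?F p i = 1"
        using rows permutes_not_in[OF F_permutes[OF p]] by auto
    qed auto
    also have "\<dots> = (\<Prod>i\<in>UNIV. M $ f i $ f (p i))"
      using inj by (simp add: prod.reindex map_permutation_apply)
    finally show ?thesis
      using sign_map_permutation[OF inj p] by simp
  qed
  have "det M = (\<Sum>p | p permutes range f. ?term p)"
    unfolding det_def
  proof (rule sum.mono_neutral_right)
    show "\<forall>p\<in>{p. p permutes UNIV} - {p. p permutes range f}. ?term p = 0"
    proof
      fix p :: "'m \<Rightarrow> 'm"
      assume "p \<in> {p. p permutes UNIV} - {p. p permutes range f}"
      then have "p permutes UNIV" "\<not> p permutes range f"
        by auto
      then obtain i where "i \<notin> range f" "p i \<noteq> i"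
        using permutes_superset[of p UNIV "range f"] by auto
      then have "M $ i $ p i = 0"
        using rows by metis
      then show "?term p = 0"
        by (metis UNIV_I finite mult_zero_right prod_zero)
    qed
  qed (auto intro: permutes_subset)
  also have "\<dots> = det (\<chi> i j. M $ f i $ f j)"
    by (simp add: reindex det_def term_F)
  finally show ?thesis .
qed

definition block_matrix ::
  "'a^'m^'m \<Rightarrow> 'a^'n^'m \<Rightarrow> 'a^'m^'n \<Rightarrow> 'a^'n^'n \<Rightarrow> 'a^('m::finite + 'n::finite)^('m + 'n)" where
  "block_matrix A B C D =
     (\<chi> s t. case s of
        Inl i \<Rightarrow> (case t of Inl j \<Rightarrow> A $ i $ j | Inr j \<Rightarrow> B $ i $ j)
      | Inr i \<Rightarrow> (case t of Inl j \<Rightarrow> C $ i $ j | Inr j \<Rightarrow> D $ i $ j))"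

lemma block_matrix_mult:
  fixes A A' :: "'a::comm_ring_1^'m::finite^'m" and D D' :: "'a^'n::finite^'n"
  shows "block_matrix A B C D ** block_matrix A' B' C' D' =
    block_matrix (A ** A' + B ** C') (A ** B' + B ** D') (C ** A' + D ** C') (C ** B' + D ** D')"
proof -
  have split: "(\<Sum>x\<in>(UNIV :: ('m + 'n) set). g x) = (\<Sum>x\<in>UNIV. g (Inl x)) + (\<Sum>x\<in>UNIV. g (Inr x))"
    for g :: "'m + 'n \<Rightarrow> 'a"
    unfolding UNIV_Plus_UNIV[symmetric] by (subst sum.Plus) (simp_all add: o_def)
  show ?thesis
    by (simp add: vec_eq_iff matrix_matrix_mult_def block_matrix_def split split: sum.split)
qed

lemma det_block_identity_lower_right:
  "det (block_matrix A B 0 (mat 1)) = det (A :: 'a::comm_ring_1^'m::finite^'m)"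
proof -
  have "det (block_matrix A B 0 (mat 1)) =
      det (\<chi> i j. block_matrix A B 0 (mat 1) $ Inl i $ Inl j)"
    by (rule det_identity_rows) (auto simp: block_matrix_def mat_def split: sum.split)
  then show ?thesis
    by (simp add: block_matrix_def)
qed

lemma det_block_identity_upper_left:
  "det (block_matrix (mat 1) B 0 D) = det (D :: 'a::comm_ring_1^'n::finite^'n)"
proof -
  let ?T = "transpose (block_matrix (mat 1) B 0 D)"
  have "det ?T = det (\<chi> i j. ?T $ Inr i $ Inr j)"
    by (rule det_identity_rows)
      (auto simp: block_matrix_def transpose_def mat_def split: sum.split)
  also have "(\<chi> i j. ?T $ Inr i $ Inr j) = transpose D"
    by (simp add: block_matrix_def transpose_def)
  finally show ?thesis
    by (simp add: det_transpose)
qed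

text \<open>
  The two factors below are chosen so that each order of multiplication clears the lower left
  block, leaving \<open>1 + U V\<close> on the diagonal in one order and \<open>1 + V U\<close> in the other.
\<close>

lemma det_one_plus_mult_commute:
  fixes U :: "'a::comm_ring_1^'n::finite^'m::finite" and V :: "'a^'m^'n"
  shows "det (mat 1 + U ** V) = det (mat 1 + V ** U)"
proof -
  let ?M = "block_matrix (mat 1) U (- V) (mat 1)"
  let ?N = "block_matrix (mat 1) 0 V (mat 1)"
  have zero: "(0 :: 'a^'k::finite^'l::finite) ** X = 0" for X :: "'a^'j::finite^'k"
    by (simp add: matrix_matrix_mult_def vec_eq_iff)
  have zero': "Y ** (0 :: 'a^'k::finite^'l::finite) = 0" for Y :: "'a^'l^'j::finite"
    by (simp add: matrix_matrix_mult_def vec_eq_iff)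
  have MN: "?M ** ?N = block_matrix (mat 1 + U ** V) U 0 (mat 1)"
    by (simp add: block_matrix_mult zero zero')
  have NM: "?N ** ?M = block_matrix (mat 1) U 0 (mat 1 + V ** U)"
    by (simp add: block_matrix_mult zero zero' add.commute)
  have "det (?M ** ?N) = det (?N ** ?M)"
    by (simp add: det_mul mult.commute)
  then show ?thesis
    unfolding MN NM det_block_identity_lower_right det_block_identity_upper_left .
qed

section \<open>The system matrix\<close>

text \<open>
  These are the two factors \<open>V\<close> (a partial trace) and \<open>U\<close>: the coupling term of the system is
  obtained by first forming the sums \<open>u\<close> and then spreading each of them over the
  entries of \<open>c\<close>.
\<close>

definition partial_trace_matrix :: "real^('n::finite \<times> 'n \<times> 'n)^'n" where
  "partial_trace_matrix = (\<chi> l t. case t of (i,j,k) \<Rightarrow> if j = l \<and> i = k then 1 else 0)"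

definition spread_matrix :: "real^'n::finite^'n \<Rightarrow> real^'n^('n \<times> 'n \<times> 'n)" where
  "spread_matrix c = (\<chi> t l. case t of (i,j,k) \<Rightarrow> if i = l then c $ j $ k else 0)"

lemma partial_trace_matrix_mult:
  "partial_trace_matrix *v a = (\<chi> l. \<Sum>q\<in>UNIV. a $ (q,l,q))"
proof -
  have "(\<Sum>t\<in>UNIV. partial_trace_matrix $ l $ t * a $ t) = (\<Sum>q\<in>UNIV. a $ (q,l,q))" for l
  proof -
    have "(\<Sum>t\<in>UNIV. partial_trace_matrix $ l $ t * a $ t) =
        (\<Sum>i\<in>UNIV. \<Sum>j\<in>UNIV. \<Sum>k\<in>UNIV. if k = i then (if j = l then a $ (i,j,k) else 0) else 0)"
      unfolding sum.cartesian_product UNIV_Times_UNIV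
      by (rule sum.cong) (auto simp: partial_trace_matrix_def split: prod.split)
    also have "\<dots> = (\<Sum>i\<in>UNIV. \<Sum>j\<in>UNIV. if j = l then a $ (i,j,i) else 0)"
      by simp
    finally show ?thesis
      by simp
  qed
  then show ?thesis
    by (simp add: vec_eq_iff matrix_vector_mult_def)
qed

lemma spread_matrix_mult: "(spread_matrix c *v u) $ (i,j,k) = c $ j $ k * u $ i"
  by (simp add: matrix_vector_mult_def spread_matrix_def if_distrib[of "\<lambda>x. x * _"] cong: if_cong)

lemma system_matrix_factorization:
  "system_matrix c = mat 1 + spread_matrix c ** partial_trace_matrix"
proof -
  have "system_matrix c *v a = (mat 1 + spread_matrix c ** partial_trace_matrix) *v a" for a
    unfolding system_matrix_mult_iff is_solution_def
    by (simp add: matrix_vector_mult_add_rdistrib matrix_vector_mul_assoc[symmetric]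
        spread_matrix_mult partial_trace_matrix_mult)
  then show ?thesis
    by (simp add: matrix_eq)
qed

lemma trace_spread_matrix: "partial_trace_matrix ** spread_matrix c = c"
proof -
  have "(partial_trace_matrix ** spread_matrix c) *v u = c *v u" for u
    unfolding matrix_vector_mul_assoc[symmetric] partial_trace_matrix_mult spread_matrix_mult
    by (simp add: matrix_vector_mult_def)
  then show ?thesis
    by (simp add: matrix_eq)
qed

lemma det_system_matrix: "det (system_matrix c) = det (mat 1 + c)"
  unfolding system_matrix_factorization det_one_plus_mult_commute trace_spread_matrix ..

lemma matrix_inv_solve:
  fixes A :: "real^'n::finite^'n"
  assumes "invertible A"
  shows "A *v x = y \<longleftrightarrow> x = matrix_inv A *v y"
proof -
  have "A ** matrix_inv A = mat 1 \<and> matrix_inv A ** A = mat 1"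
    using assms unfolding invertible_def matrix_inv_def by (rule someI_ex)
  then show ?thesis
    by (metis matrix_vector_mul_assoc matrix_vector_mul_lid)
qed

text \<open>Setting \<open>k = i\<close> and summing the equations over \<open>i\<close> gives, for each \<open>j\<close>, the
  \<open>j\<close>-th row of \<open>(1 + c) u = h\<close> for the coupling sums \<open>u\<close>.\<close>

lemma is_solution_formula:
  assumes "invertible (mat 1 + c)" and "is_solution c b a"
  shows "a $ (i,j,k) = b $ (i,j,k) -
    c $ j $ k * (matrix_inv (mat 1 + c) *v (\<chi> l. \<Sum>q\<in>UNIV. b $ (q,l,q))) $ i"
proof -
  define u where "u = partial_trace_matrix *v a"
  have "a + spread_matrix c *v u = b"
    using assms(2) by (simp add: vec_eq_iff is_solution_def u_def partial_trace_matrix_mult spread_matrix_mult)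
  then have "partial_trace_matrix *v b = u + (partial_trace_matrix ** spread_matrix c) *v u"
    by (metis u_def matrix_vector_right_distrib matrix_vector_mul_assoc)
  then have "(mat 1 + c) *v u = partial_trace_matrix *v b"
    by (simp add: trace_spread_matrix matrix_vector_mult_add_rdistrib)
  then have "u = matrix_inv (mat 1 + c) *v (\<chi> l. \<Sum>q\<in>UNIV. b $ (q,l,q))"
    using matrix_inv_solve[OF assms(1)] by (simp add: partial_trace_matrix_mult)
  moreover have "a $ (i,j,k) = b $ (i,j,k) - c $ j $ k * u $ i"
    using \<open>a + spread_matrix c *v u = b\<close> by (auto simp: spread_matrix_mult)
  ultimately show ?thesis
    by simp
qed

section \<open>Positive semi-definite matrices\<close>

text \<open>Cauchy-Schwarz applied to \<open>|x|\<^sup>2 \<le> x \<bullet> (1 + c) x\<close>.\<close>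

lemma norm_le_one_plus_pos_semidef:
  assumes "pos_semidef c"
  shows "norm x \<le> norm ((mat 1 + c) *v x)"
proof -
  have "0 \<le> x \<bullet> (c *v x)"
    using assms by (simp add: pos_semidef_def)
  then have "norm x * norm x \<le> x \<bullet> ((mat 1 + c) *v x)"
    by (simp add: matrix_vector_mult_add_rdistrib inner_add_right dot_square_norm power2_eq_square)
  also have "\<dots> \<le> norm x * norm ((mat 1 + c) *v x)"
    by (rule norm_cauchy_schwarz)
  finally show ?thesis
    by (cases "x = 0") auto
qed

lemma invertible_one_plus_pos_semidef:
  fixes c :: "real^'n::finite^'n"
  assumes "pos_semidef c"
  shows "invertible (mat 1 + c)"
proof -
  have "x = 0" if "(mat 1 + c) *v x = 0" for x
    using norm_le_one_plus_pos_semidef[OF assms, of x] that by simp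
  then show ?thesis
    unfolding invertible_left_inverse matrix_left_invertible_ker by blast
qed

lemma norm_inverse_one_plus_pos_semidef:
  assumes "pos_semidef c"
  shows "norm (matrix_inv (mat 1 + c) *v x) \<le> norm x"
  using norm_le_one_plus_pos_semidef[OF assms, of "matrix_inv (mat 1 + c) *v x"]
    matrix_inv_solve[OF invertible_one_plus_pos_semidef[OF assms]] by metis

text \<open>
  In the explicit solution formula the factor \<open>c\<^sub>j\<^sub>k\<close> is at most \<open>1\<close> in absolute value, and the
  norm of the vector \<open>h\<close> is estimated by the sum of its \<open>n\<close> entries, each a sum of \<open>n\<close> entries
  of \<open>b\<close>. The inverse of \<open>1 + c\<close> does not increase that norm.
\<close>

lemma SUP_solution_le:
  fixes c :: "real^'n::finite^'n"
  assumes psd: "pos_semidef c" and entries: "\<And>j k. \<bar>c $ j $ k\<bar> \<le> 1"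
    and sol: "is_solution c b a"
  shows "(SUP t. \<bar>a $ t\<bar>) \<le> (1 + (real CARD('n))\<^sup>2) * (SUP t. \<bar>b $ t\<bar>)"
proof (rule cSUP_least)
  fix t :: "'n \<times> 'n \<times> 'n"
  obtain i j k where t: "t = (i,j,k)"
    by (metis prod_cases3)
  define B where "B = (SUP t. \<bar>b $ t\<bar>)"
  define h where "h = (\<chi> l. \<Sum>q\<in>UNIV. b $ (q,l,q))"
  let ?u = "matrix_inv (mat 1 + c) *v h"
  have b_le: "\<bar>b $ s\<bar> \<le> B" for s
    unfolding B_def by (rule cSUP_upper) auto
  have "\<bar>h $ l\<bar> \<le> real CARD('n) * B" for l
    unfolding h_def using sum_norm_bound[of UNIV "\<lambda>q. b $ (q,l,q)" B] b_le by simp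
  then have "(\<Sum>l\<in>UNIV. \<bar>h $ l\<bar>) \<le> real CARD('n) * (real CARD('n) * B)"
    using sum_bounded_above[of UNIV "\<lambda>l. \<bar>h $ l\<bar>"] by simp
  then have "norm h \<le> (real CARD('n))\<^sup>2 * B"
    using norm_le_l1_cart[of h] by (simp add: power2_eq_square mult.assoc)
  then have u_le: "\<bar>?u $ i\<bar> \<le> (real CARD('n))\<^sup>2 * B"
    using component_le_norm_cart[of ?u i] norm_inverse_one_plus_pos_semidef[OF psd, of h] by linarith
  have "\<bar>c $ j $ k * ?u $ i\<bar> \<le> 1 * \<bar>?u $ i\<bar>"
    unfolding abs_mult by (intro mult_right_mono entries) auto
  moreover have "a $ t = b $ t - c $ j $ k * ?u $ i"
    unfolding t h_def by (rule is_solution_formula[OF invertible_one_plus_pos_semidef[OF psd] sol])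
  ultimately have "\<bar>a $ t\<bar> \<le> B + (real CARD('n))\<^sup>2 * B"
    using b_le[of t] u_le by linarith
  then show "\<bar>a $ t\<bar> \<le> (1 + (real CARD('n))\<^sup>2) * (SUP t. \<bar>b $ t\<bar>)"
    by (simp add: B_def algebra_simps)
qed simp

section \<open>Orthogonal projections and their averages\<close>

lemma transpose_eq_self_iff:
  fixes A :: "real^'n::finite^'n"
  shows "transpose A = A \<longleftrightarrow> (\<forall>x y. x \<bullet> (A *v y) = y \<bullet> (A *v x))"
proof
  assume "transpose A = A"
  then have "x \<bullet> (A *v y) = (A *v x) \<bullet> y" for x y
    by (metis dot_lmul_matrix transpose_matrix_vector)
  then show "\<forall>x y. x \<bullet> (A *v y) = y \<bullet> (A *v x)"
    by (simp add: inner_commute)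
next
  assume sym: "\<forall>x y. x \<bullet> (A *v y) = y \<bullet> (A *v x)"
  have "axis i 1 \<bullet> (A *v axis j 1) = A $ i $ j" for i j
    by (simp add: inner_axis' matrix_vector_mul_component inner_axis)
  then show "transpose A = A"
    using sym by (metis (no_types, lifting) transpose_def vec_eq_iff vec_lambda_beta)
qed

text \<open>
  The right-hand side is symmetric in \<open>x\<close> and \<open>y\<close> and a square for \<open>x = y\<close>. This gives the
  symmetry, the positivity and, by Cauchy-Schwarz, the contractivity of \<open>P\<close>.
\<close>

lemma inner_orth_projection:
  assumes "is_orth_projection_onto P S"
  shows "x \<bullet> (P *v y) = (P *v x) \<bullet> (P *v y)"
proof -
  have "(x - P *v x) \<bullet> (P *v y) = 0"
    using assms by (auto simp: is_orth_projection_onto_def)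
  then show ?thesis
    by (simp add: inner_diff_left)
qed

lemma pos_semidef_orth_projection:
  assumes "is_orth_projection_onto P S"
  shows "pos_semidef P"
  unfolding pos_semidef_def transpose_eq_self_iff
  using inner_orth_projection[OF assms] by (metis inner_commute inner_ge_zero)

lemma norm_orth_projection_le:
  assumes "is_orth_projection_onto P S"
  shows "norm (P *v x) \<le> norm x"
proof -
  have "norm (P *v x) * norm (P *v x) \<le> norm x * norm (P *v x)"
    using inner_orth_projection[OF assms, of x x] norm_cauchy_schwarz[of x "P *v x"]
    by (simp add: dot_square_norm power2_eq_square)
  then show ?thesis
    by (cases "P *v x = 0") auto
qed

lemma orth_projection_entry_le:
  assumes "is_orth_projection_onto P S"
  shows "\<bar>P $ j $ k\<bar> \<le> 1"
proof -
  have "P $ j $ k = (P *v axis k 1) $ j"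
    by (simp add: matrix_vector_mul_component inner_axis)
  then show ?thesis
    using component_le_norm_cart[of "P *v axis k 1" j] norm_orth_projection_le[OF assms, of "axis k 1"]
    by (simp add: norm_axis_1)
qed

text \<open>
  Entries bounded by \<open>1\<close> make the identity integrable over the Grassmannian, so every linear
  functional may be moved inside the integral that defines \<open>c\<close>.
\<close>

lemma is_grassmannian_averageE:
  fixes c :: "real^'n::finite^'n"
  assumes "is_grassmannian_average d c"
  obtains \<nu> :: "(real^'n^'n) measure" where
    "prob_space \<nu>" "space \<nu> = grassmannian d"
    "\<And>\<phi> :: real^'n^'n \<Rightarrow> real. linear \<phi> \<Longrightarrow> integrable \<nu> \<phi> \<and> \<phi> c = (\<integral>S. \<phi> S \<partial>\<nu>)"
proof -
  obtain \<nu> :: "(real^'n^'n) measure" where prob: "prob_space \<nu>"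
    and sets: "sets \<nu> = sets (restrict_space borel (grassmannian d))" and c: "c = (\<integral>S. S \<partial>\<nu>)"
    using assms by (auto simp: is_grassmannian_average_def)
  have space: "space \<nu> = grassmannian d"
    using sets_eq_imp_space_eq[OF sets] by (simp add: space_restrict_space)
  interpret prob_space \<nu> by (rule prob)
  have "norm S \<le> real CARD('n) * real CARD('n)" if S: "S \<in> space \<nu>" for S
  proof -
    have "\<bar>S $ j $ k\<bar> \<le> 1" for j k
      using S orth_projection_entry_le unfolding space grassmannian_def by blast
    then have "norm (S $ j) \<le> real CARD('n)" for j
      using norm_le_l1_cart[of "S $ j"] sum_bounded_above[of UNIV "\<lambda>k. \<bar>S $ j $ k\<bar>" 1]
      by (smt (verit, best) mult.right_neutral)
    moreover have "norm S \<le> (\<Sum>j\<in>UNIV. norm (S $ j))"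
      by (simp add: norm_vec_def L2_set_le_sum)
    ultimately show ?thesis
      using sum_bounded_above[of UNIV "\<lambda>j. norm (S $ j)" "real CARD('n)"] by fastforce
  qed
  moreover have "(\<lambda>S. S) \<in> borel_measurable \<nu>"
    by (subst measurable_cong_sets[OF sets refl]) (simp add: measurable_restrict_space1)
  ultimately have int: "integrable \<nu> (\<lambda>S. S)"
    by (intro integrable_const_bound) auto
  show thesis
  proof (rule that[OF prob space])
    fix \<phi> :: "real^'n^'n \<Rightarrow> real"
    assume "linear \<phi>"
    then have "bounded_linear \<phi>"
      by (simp add: linear_conv_bounded_linear)
    then show "integrable \<nu> \<phi> \<and> \<phi> c = (\<integral>S. \<phi> S \<partial>\<nu>)"
      using int integrable_bounded_linear[of \<phi> \<nu> "\<lambda>S. S"] integral_bounded_linear[of \<phi> \<nu> "\<lambda>S. S"] c by simp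
  qed
qed

lemma grassmannian_average_nonneg:
  fixes c :: "real^'n::finite^'n"
  assumes "is_grassmannian_average d c" and "linear \<phi>"
    and "\<And>S. S \<in> grassmannian d \<Longrightarrow> 0 \<le> (\<phi> S :: real)"
  shows "0 \<le> \<phi> c"
  using assms(1)
proof (rule is_grassmannian_averageE)
  fix \<nu> :: "(real^'n^'n) measure"
  assume space: "space \<nu> = grassmannian d"
    and functional: "\<And>\<phi> :: _ \<Rightarrow> real. linear \<phi> \<Longrightarrow> integrable \<nu> \<phi> \<and> \<phi> c = (\<integral>S. \<phi> S \<partial>\<nu>)"
  have "\<phi> c = (\<integral>S. \<phi> S \<partial>\<nu>)"
    using functional[OF assms(2)] by blast
  also have "\<dots> \<ge> 0"
    using assms(3) by (intro integral_nonneg_AE AE_I2) (simp add: space)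
  finally show ?thesis .
qed

lemma pos_semidef_grassmannian_average:
  fixes c :: "real^'n::finite^'n"
  assumes "is_grassmannian_average d c"
  shows "pos_semidef c"
proof -
  have psd: "pos_semidef S" if "S \<in> grassmannian d" for S :: "real^'n^'n"
    using that pos_semidef_orth_projection by (auto simp: grassmannian_def)
  \<comment> \<open>Exchanging \<open>x\<close> and \<open>y\<close> turns this inequality into its reverse, so it yields equality.\<close>
  have "0 \<le> x \<bullet> (c *v y) - y \<bullet> (c *v x)" for x y
  proof (rule grassmannian_average_nonneg[OF assms])
    show "linear (\<lambda>S. x \<bullet> (S *v y) - y \<bullet> (S *v x))"
      by (rule linearI) (simp_all add: matrix_vector_mult_add_rdistrib inner_add_right
          scaleR_matrix_vector_assoc[symmetric] algebra_simps)
    show "0 \<le> x \<bullet> (S *v y) - y \<bullet> (S *v x)" if "S \<in> grassmannian d" for S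
      using psd[OF that] unfolding pos_semidef_def transpose_eq_self_iff by (metis diff_self order_refl)
  qed
  then have "\<forall>x y. x \<bullet> (c *v y) = y \<bullet> (c *v x)"
    by (metis antisym diff_ge_0_iff_ge)
  moreover have "0 \<le> x \<bullet> (c *v x)" for x
  proof (rule grassmannian_average_nonneg[OF assms])
    show "linear (\<lambda>S. x \<bullet> (S *v x))"
      by (rule linearI) (simp_all add: matrix_vector_mult_add_rdistrib inner_add_right
          scaleR_matrix_vector_assoc[symmetric])
    show "0 \<le> x \<bullet> (S *v x)" if "S \<in> grassmannian d" for S
      using psd[OF that] by (simp add: pos_semidef_def)
  qed
  ultimately show ?thesis
    by (simp add: pos_semidef_def transpose_eq_self_iff)
qed

lemma grassmannian_average_entry_le:
  fixes c :: "real^'n::finite^'n"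
  assumes "is_grassmannian_average d c"
  shows "\<bar>c $ j $ k\<bar> \<le> 1"
  using assms
proof (rule is_grassmannian_averageE)
  fix \<nu> :: "(real^'n^'n) measure"
  assume prob: "prob_space \<nu>" and space: "space \<nu> = grassmannian d"
    and functional: "\<And>\<phi> :: _ \<Rightarrow> real. linear \<phi> \<Longrightarrow> integrable \<nu> \<phi> \<and> \<phi> c = (\<integral>S. \<phi> S \<partial>\<nu>)"
  interpret prob_space \<nu> by (rule prob)
  have "linear (\<lambda>S :: real^'n^'n. S $ j $ k)"
    by (rule linearI) auto
  then have int: "integrable \<nu> (\<lambda>S. S $ j $ k)" and c: "c $ j $ k = (\<integral>S. S $ j $ k \<partial>\<nu>)"
    using functional by blast+
  have entry: "\<bar>S $ j $ k\<bar> \<le> 1" if "S \<in> space \<nu>" for S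
    using that orth_projection_entry_le unfolding space grassmannian_def by blast
  have "c $ j $ k \<le> 1"
    unfolding c by (rule integral_le_const[OF int]) (use entry in \<open>auto intro!: AE_I2 simp: abs_le_iff\<close>)
  moreover have "-1 \<le> c $ j $ k"
    unfolding c by (rule integral_ge_const[OF int]) (use entry in \<open>force intro!: AE_I2 simp: abs_le_iff\<close>)
  ultimately show ?thesis
    by simp
qed

theorem lemma3p4:
  fixes d :: nat
  assumes "1 \<le> d" and "d \<le> CARD('n::finite)"
  shows
    "(\<forall>c :: real^'n^'n. pos_semidef c \<longrightarrow>
        invertible (system_matrix c) \<and>
        det (system_matrix c) = det (mat 1 + c) \<and>
        (\<forall>b. (\<exists>!a. is_solution c b a) \<and>
             (\<forall>a. is_solution c b a \<longrightarrow>
                (\<forall>i j k. a $ (i,j,k) =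
                   b $ (i,j,k) -
                   c $ j $ k * (matrix_inv (mat 1 + c) *v (\<chi> l. \<Sum>q\<in>UNIV. b $ (q,l,q))) $ i)))) \<and>
     (\<forall>c :: real^'n^'n.
        (is_orth_projector c \<and> rank c = d) \<or> is_grassmannian_average d c \<longrightarrow> pos_semidef c) \<and>
     (\<exists>C\<^sub>0 > 0. \<forall>c :: real^'n^'n.
        (is_orth_projector c \<and> rank c = d) \<or> is_grassmannian_average d c \<longrightarrow>
        onorm (\<lambda>x. matrix_inv (mat 1 + c) *v x) \<le> C\<^sub>0 \<and>
        (\<forall>b a. is_solution c b a \<longrightarrow>
           (SUP t. \<bar>a $ t\<bar>) \<le> C\<^sub>0 * (SUP t. \<bar>b $ t\<bar>)))"
proof (intro conjI allI impI)
  fix c :: "real^'n^'n"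
  assume psd: "pos_semidef c"
  note inv = invertible_one_plus_pos_semidef[OF psd]
  show "det (system_matrix c) = det (mat 1 + c)"
    by (rule det_system_matrix)
  with inv show inv_system: "invertible (system_matrix c)"
    by (simp add: invertible_det_nz)
  show "\<exists>!a. is_solution c b a" for b
    unfolding system_matrix_mult_iff[symmetric] matrix_inv_solve[OF inv_system] by simp
  show "a $ (i,j,k) = b $ (i,j,k) -
      c $ j $ k * (matrix_inv (mat 1 + c) *v (\<chi> l. \<Sum>q\<in>UNIV. b $ (q,l,q))) $ i"
    if "is_solution c b a" for a b i j k
    using is_solution_formula[OF inv that] .
next
  fix c :: "real^'n^'n"
  assume "(is_orth_projector c \<and> rank c = d) \<or> is_grassmannian_average d c"
  then show "pos_semidef c"
    using pos_semidef_orth_projection pos_semidef_grassmannian_average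
    by (auto simp: is_orth_projector_def)
next
  let ?C = "1 + (real CARD('n))\<^sup>2"
  show "\<exists>C\<^sub>0 > 0. \<forall>c :: real^'n^'n.
      (is_orth_projector c \<and> rank c = d) \<or> is_grassmannian_average d c \<longrightarrow>
      onorm (\<lambda>x. matrix_inv (mat 1 + c) *v x) \<le> C\<^sub>0 \<and>
      (\<forall>b a. is_solution c b a \<longrightarrow> (SUP t. \<bar>a $ t\<bar>) \<le> C\<^sub>0 * (SUP t. \<bar>b $ t\<bar>))"
  proof (intro exI[of _ ?C] conjI allI impI)
    show "0 < ?C"
      by (simp add: add_pos_nonneg)
    fix c :: "real^'n^'n"
    assume c: "(is_orth_projector c \<and> rank c = d) \<or> is_grassmannian_average d c"
    then have psd: "pos_semidef c"
      using pos_semidef_orth_projection pos_semidef_grassmannian_average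
      by (auto simp: is_orth_projector_def)
    have entries: "\<bar>c $ j $ k\<bar> \<le> 1" for j k
      using c orth_projection_entry_le grassmannian_average_entry_le
      by (auto simp: is_orth_projector_def)
    have "onorm (\<lambda>x. matrix_inv (mat 1 + c) *v x) \<le> 1"
      using norm_inverse_one_plus_pos_semidef[OF psd] by (intro onorm_bound) auto
    also have "1 \<le> ?C"
      by simp
    finally show "onorm (\<lambda>x. matrix_inv (mat 1 + c) *v x) \<le> ?C" .
    show "(SUP t. \<bar>a $ t\<bar>) \<le> ?C * (SUP t. \<bar>b $ t\<bar>)" if "is_solution c b a" for a b
      using SUP_solution_le[OF psd entries that] .
  qed
qed

end
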